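(* Let $p\ge 2$, $L>0$, and let $f:\mathbb{R}^d\to\mathbb{R}$ be convex and $L$-smooth with respect to $\|\cdot\|_p$, with minimizer $x^*$. Let $T>0$ be an integer, let $x_1,\dots,x_T$ be the iterates generated by $T$ iterations of Algorithm HASD started at $x_0\in\mathbb{R}^d$, and let $$\mathcal{G} := \frac{1}{T}\sum_{t=0}^{T-1}\frac{\|\nabla f(x_{t+1})\|_{p^*}}{\|\nabla f(x_{t+1})\|_2}.$$ Then the output $x_T$ of HASD satisfies $$f(x_T)-f(x^* )\le \frac{324\,L\,\|x_0-x^*\|_2^2}{\mathcal{G}^2T^2}.$$
   Context: $p\ge 2$ is a real number, $\|\cdot\|_p$ is the $\ell_p$ norm on $\mathbb{R}^d$ and $\|\cdot\|_{p^*}$ its dual norm ($p^*=p/(p-1)$). A differentiable $f$ is $L$-smooth with respect to $\|\cdot\|_p$ if $\|\nabla f(y)-\nabla f(x)\|_{p^*}\le L\|y-x\|_p$ for all $x,y\in\mathbb{R}^d$. Algorithm HASD (Hyper-Accelerated Steepest Descent). Input: $x_0\in\mathbb{R}^d$; $A_0=0$; $\psi_0(x):=\frac12\|x-x_0\|_2^2$. For $t=0,\dots,T-1$: 1. $v_t=\arg\min_{x\in\mathbb{R}^d}\psi_t(x)$. 2. Determine $\rho_t>0$ and $x_{t+1}\in\mathbb{R}^d$ such that the following hold simultaneously: (i) $\frac12\frac{\|\nabla f(x_{t+1})\|_2^2}{\|\nabla f(x_{t+1})\|_{p^*}^2}\le\rho_t\le 2\frac{\|\nabla f(x_{t+1})\|_2^2}{\|\nabla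 f(x_{t+1})\|_{p^*}^2}$; (ii) $a_{t+1}>0$ satisfies $a_{t+1}^2=\frac{A_t+a_{t+1}}{18L\rho_t}$; (iii) $A_{t+1}=A_t+a_{t+1}$, $\tau_t=\frac{a_{t+1}}{A_{t+1}}$; (iv) $y_t=(1-\tau_t)x_t+\tau_tv_t$; (v) $x_{t+1}=\arg\min_{x\in\mathbb{R}^d}\{\langle\nabla f(y_t),x-y_t\rangle+L\|x-y_t\|_p^2\}$. 3. $\psi_{t+1}(x)=\psi_t(x)+a_{t+1}[f(x_{t+1})+\langle\nabla f(x_{t+1}),x-x_{t+1}\rangle]$. Output: $x_T$. It is understood that the ratios are well defined, i.e. $\nabla f(x_{t+1})\ne0$ for each generated iterate, and that a pair $(\rho_t,x_{t+1})$ as in step 2 is used at every iteration. *)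

theory Defs
  imports "HOL-Analysis.Analysis"
begin

text \<open>Meant for real exponents \<open>p \<ge> 1\<close>. The case \<open>p = 2\<close> is the library \<^const>\<open>norm\<close> on
  \<^typ>\<open>real ^ 'n\<close>, which is written for the Euclidean norm throughout.\<close>

definition lp_norm :: "real \<Rightarrow> real ^ 'n \<Rightarrow> real"
  where "lp_norm p x = (\<Sum>i\<in>UNIV. \<bar>x $ i\<bar> powr p) powr (1 / p)"

lemma lp_norm_2: "lp_norm 2 x = norm x"
  by (simp add: lp_norm_def norm_vec_def L2_set_def powr_half_sqrt sum_nonneg)

definition dual_exponent :: "real \<Rightarrow> real"
  where "dual_exponent p = p / (p - 1)"

definition grad :: "('a::real_inner \<Rightarrow> real) \<Rightarrow> 'a \<Rightarrow> 'a"
  where "grad f x = (THE D. GDERIV f x :> D)"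

lemma grad_eqI:
  assumes "GDERIV f x :> D"
  shows "grad f x = D"
  unfolding grad_def
proof (rule the_equality)
  fix E assume "GDERIV f x :> E"
  with assms have "(\<lambda>h. inner h D) = (\<lambda>h. inner h E)"
    unfolding gderiv_def by (rule has_derivative_unique)
  then have "inner (E - D) (E - D) = 0"
    by (metis inner_diff_right right_minus_eq)
  then show "E = D" by simp
qed (fact assms)

lemma differentiable_imp_GDERIV_grad:
  fixes f :: "'a::euclidean_space \<Rightarrow> real"
  assumes "f differentiable (at x)"
  shows "GDERIV f x :> grad f x"
proof -
  obtain f' where f': "(f has_derivative f') (at x)"
    using assms by (auto simp: differentiable_def)
  then interpret bounded_linear f' by (rule has_derivative_bounded_linear)
  have "f' = (\<lambda>h. inner h (\<Sum>b\<in>Basis. f' b *\<^sub>R b))"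
  proof
    fix h
    have "f' h = f' (\<Sum>b\<in>Basis. inner h b *\<^sub>R b)" by (simp add: euclidean_representation)
    also have "\<dots> = (\<Sum>b\<in>Basis. inner h b * f' b)" by (simp add: sum scaleR)
    finally show "f' h = inner h (\<Sum>b\<in>Basis. f' b *\<^sub>R b)"
      by (simp add: inner_sum_right mult.commute)
  qed
  with f' have "GDERIV f x :> (\<Sum>b\<in>Basis. f' b *\<^sub>R b)" by (simp add: gderiv_def)
  then show ?thesis using grad_eqI by metis
qed

definition lp_smooth :: "real \<Rightarrow> real \<Rightarrow> (real ^ 'n \<Rightarrow> real) \<Rightarrow> bool"
  where "lp_smooth p L f \<longleftrightarrow>
    (\<forall>x. f differentiable (at x)) \<and>
    (\<forall>x y. lp_norm (dual_exponent p) (grad f y - grad f x) \<le> L * lp_norm p (y - x))"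

abbreviation minimizes :: "('a \<Rightarrow> real) \<Rightarrow> 'a \<Rightarrow> bool"
  where "minimizes h z \<equiv> is_arg_min h (\<lambda>_. True) z"

text \<open>The algorithm is a relation on the sequences of all quantities it produces, because
  \<open>\<rho> t\<close> and \<open>x (Suc t)\<close> are determined implicitly by simultaneous conditions. Only the entries
  of iterations \<open>t < T\<close> are constrained. The conjunct \<open>grad f (x (Suc t)) \<noteq> 0\<close> makes the
  ratios bounding \<open>\<rho> t\<close> well defined.\<close>

definition hasd_step :: "real \<Rightarrow> real \<Rightarrow> (real ^ 'n \<Rightarrow> real) \<Rightarrow>
    (nat \<Rightarrow> real ^ 'n) \<Rightarrow> (nat \<Rightarrow> real ^ 'n) \<Rightarrow> (nat \<Rightarrow> real ^ 'n) \<Rightarrow> (nat \<Rightarrow> real ^ 'n \<Rightarrow> real) \<Rightarrow>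
    (nat \<Rightarrow> real) \<Rightarrow> (nat \<Rightarrow> real) \<Rightarrow> (nat \<Rightarrow> real) \<Rightarrow> (nat \<Rightarrow> real) \<Rightarrow> nat \<Rightarrow> bool"
  where "hasd_step p L f x v y \<psi> \<rho> a A \<tau> t \<longleftrightarrow>
    minimizes (\<psi> t) (v t) \<and>
    grad f (x (Suc t)) \<noteq> 0 \<and>
    \<rho> t > 0 \<and>
    1/2 * ((norm (grad f (x (Suc t))))\<^sup>2 / (lp_norm (dual_exponent p) (grad f (x (Suc t))))\<^sup>2) \<le> \<rho> t \<and>
    \<rho> t \<le> 2 * ((norm (grad f (x (Suc t))))\<^sup>2 / (lp_norm (dual_exponent p) (grad f (x (Suc t))))\<^sup>2) \<and>
    a (Suc t) > 0 \<and>
    (a (Suc t))\<^sup>2 = (A t + a (Suc t)) / (18 * L * \<rho> t) \<and>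
    A (Suc t) = A t + a (Suc t) \<and>
    \<tau> t = a (Suc t) / A (Suc t) \<and>
    y t = (1 - \<tau> t) *\<^sub>R x t + \<tau> t *\<^sub>R v t \<and>
    minimizes (\<lambda>z. inner (grad f (y t)) (z - y t) + L * (lp_norm p (z - y t))\<^sup>2) (x (Suc t)) \<and>
    (\<forall>z. \<psi> (Suc t) z =
      \<psi> t z + a (Suc t) * (f (x (Suc t)) + inner (grad f (x (Suc t))) (z - x (Suc t))))"

definition hasd_run :: "real \<Rightarrow> real \<Rightarrow> (real ^ 'n \<Rightarrow> real) \<Rightarrow> nat \<Rightarrow> real ^ 'n \<Rightarrow>
    (nat \<Rightarrow> real ^ 'n) \<Rightarrow> (nat \<Rightarrow> real ^ 'n) \<Rightarrow> (nat \<Rightarrow> real ^ 'n) \<Rightarrow> (nat \<Rightarrow> real ^ 'n \<Rightarrow> real) \<Rightarrow>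
    (nat \<Rightarrow> real) \<Rightarrow> (nat \<Rightarrow> real) \<Rightarrow> (nat \<Rightarrow> real) \<Rightarrow> (nat \<Rightarrow> real) \<Rightarrow> bool"
  where "hasd_run p L f T x0 x v y \<psi> \<rho> a A \<tau> \<longleftrightarrow>
    x 0 = x0 \<and> A 0 = 0 \<and> (\<forall>z. \<psi> 0 z = 1/2 * (norm (z - x0))\<^sup>2) \<and>
    (\<forall>t<T. hasd_step p L f x v y \<psi> \<rho> a A \<tau> t)"

end

theory Submission
  imports Defs
begin

text \<open>This is an estimating-sequence argument. Each \<open>\<psi> t\<close> is \<open>1\<close>-strongly convex,
  lies above \<open>A t * f (x t)\<close>, and lies below \<open>1/2 * (norm (z - x0))\<^sup>2 + A t * f z\<close>; comparing both
  bounds at \<open>xstar\<close> gives \<open>f (x T) - f xstar \<le> (norm (x0 - xstar))\<^sup>2 / (2 * A T)\<close>.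
  The lower bound survives a step because the optimality of \<open>x (Suc t)\<close> and smoothness give
  \<open>inner (grad f (x (Suc t))) (y t - x (Suc t)) \<ge> (lp_norm p* (grad f (x (Suc t))))\<^sup>2 / (9 * L)\<close>,
  where \<open>p*\<close> is the dual exponent, and the choice of \<open>a\<close> and \<open>\<rho>\<close> makes this absorb the Euclidean term
  \<open>a\<^sup>2/2 * (norm (grad f (x (Suc t))))\<^sup>2\<close>. Finally \<open>sqrt (A t)\<close> grows in each step by at least
  the current ratio of the dual norm to the Euclidean norm, divided by \<open>12 * sqrt L\<close>.\<close>

section \<open>Norms \<open>lp_norm p\<close>, the Hoelder inequality and duality\<close>

lemma lp_norm_nonneg: "lp_norm p x \<ge> 0"
  by (simp add: lp_norm_def)

lemma lp_norm_scaleR: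
  assumes "p > 0"
  shows "lp_norm p (c *\<^sub>R x) = \<bar>c\<bar> * lp_norm p x"
proof -
  have "(\<Sum>i\<in>UNIV. \<bar>(c *\<^sub>R x) $ i\<bar> powr p) = \<bar>c\<bar> powr p * (\<Sum>i\<in>UNIV. \<bar>x $ i\<bar> powr p)"
    by (simp add: abs_mult powr_mult sum_distrib_left)
  then show ?thesis
    using assms by (simp add: lp_norm_def powr_mult sum_nonneg powr_powr)
qed

lemma lp_norm_powr:
  assumes "p > 0"
  shows "lp_norm p x powr p = (\<Sum>i\<in>UNIV. \<bar>x $ i\<bar> powr p)"
  using assms by (simp add: lp_norm_def powr_powr sum_nonneg)

lemma lp_norm_eq_0_iff:
  assumes "p > 0"
  shows "lp_norm p x = 0 \<longleftrightarrow> x = 0"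
proof -
  have "lp_norm p x = 0 \<longleftrightarrow> (\<forall>i. \<bar>x $ i\<bar> powr p = 0)"
    using assms by (simp add: lp_norm_def sum_nonneg_eq_0_iff)
  then show ?thesis
    by (simp add: vec_eq_iff)
qed

lemma lp_norm_pos:
  assumes "p > 0" and "x \<noteq> 0"
  shows "lp_norm p x > 0"
  using assms lp_norm_nonneg[of p x] by (simp add: lp_norm_eq_0_iff less_le)

lemma dual_exponent_props:
  assumes "p > 1"
  shows "dual_exponent p > 1" "1 / dual_exponent p + 1 / p = 1" "(dual_exponent p - 1) * p = dual_exponent p"
  using assms by (auto simp: dual_exponent_def field_simps)

text \<open>Dividing both vectors by their norms reduces the claim to Young's inequality in each
  coordinate; zero vectors are split off because they cannot be normalised.\<close>

lemma Holder_inner: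
  fixes u h :: "real ^ 'n"
  assumes p: "p > 1"
  shows "inner u h \<le> lp_norm (dual_exponent p) u * lp_norm p h"
proof (cases "u = 0 \<or> h = 0")
  case True
  then show ?thesis by (auto simp: lp_norm_nonneg)
next
  case False
  define q where "q = dual_exponent p"
  have q: "q > 1" "1 / q + 1 / p = 1"
    using dual_exponent_props[OF p] by (auto simp: q_def)
  define U where "U = lp_norm q u"
  define H where "H = lp_norm p h"
  have pos: "U > 0" "H > 0"
    using False p q by (simp_all add: U_def H_def lp_norm_pos)
  have norm1: "(\<Sum>i\<in>UNIV. (\<bar>u $ i\<bar> / U) powr q) = 1" "(\<Sum>i\<in>UNIV. (\<bar>h $ i\<bar> / H) powr p) = 1"
    using pos p q lp_norm_powr[of q u, symmetric] lp_norm_powr[of p h, symmetric]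
    by (simp_all add: powr_divide U_def H_def flip: sum_divide_distrib)
  have "inner u h \<le> (\<Sum>i\<in>UNIV. \<bar>u $ i\<bar> * \<bar>h $ i\<bar>)"
    unfolding inner_vec_def by (intro sum_mono) (simp add: flip: abs_mult)
  also have "\<dots> = U * H * (\<Sum>i\<in>UNIV. (\<bar>u $ i\<bar> / U) * (\<bar>h $ i\<bar> / H))"
    using pos by (simp add: sum_distrib_left)
  also have "\<dots> \<le> U * H * (\<Sum>i\<in>UNIV. (\<bar>u $ i\<bar> / U) powr q / q + (\<bar>h $ i\<bar> / H) powr p / p)"
    using pos p q by (intro mult_left_mono sum_mono Youngs_inequality) auto
  also have "\<dots> = U * H * (1 / q + 1 / p)"
    by (simp add: sum.distrib norm1 flip: sum_divide_distrib)
  finally show ?thesis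
    by (simp add: q(2)) (simp add: U_def H_def q_def)
qed

text \<open>Hoelder is an equality for the vector with entries
  \<open>sgn (g $ i) * \<bar>g $ i\<bar> powr (q - 1)\<close>, where \<open>q\<close> is the dual
  exponent; rescaling it matches the two norms. The vector serves as a test direction in
  \<open>dual_norm_triangle\<close> and \<open>lp_smooth_descent\<close>.\<close>

lemma lp_duality_map:
  fixes g :: "real ^ 'n"
  assumes p: "p > 1"
  obtains w where "lp_norm p w = lp_norm (dual_exponent p) g"
    "inner g w = (lp_norm (dual_exponent p) g)\<^sup>2"
proof (cases "g = 0")
  case True
  have "lp_norm p (0 :: real ^ 'n) = 0" "lp_norm (dual_exponent p) (0 :: real ^ 'n) = 0"
    using p dual_exponent_props[OF p] by (simp_all add: lp_norm_eq_0_iff)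
  with True show ?thesis
    by (intro that[of 0]) auto
next
  case False
  define q where "q = dual_exponent p"
  have q: "q > 1" "1 / q + 1 / p = 1" "(q - 1) * p = q"
    using dual_exponent_props[OF p] by (auto simp: q_def)
  define w :: "real ^ 'n" where "w = (\<chi> i. sgn (g $ i) * \<bar>g $ i\<bar> powr (q - 1))"
  define S where "S = (\<Sum>i\<in>UNIV. \<bar>g $ i\<bar> powr q)"
  have "\<bar>w $ i\<bar> = \<bar>g $ i\<bar> powr (q - 1)" for i
    by (simp add: w_def abs_mult sgn_if)
  then have w: "lp_norm p w = S powr (1 / p)"
    by (simp add: lp_norm_def S_def powr_powr q)
  have g: "lp_norm q g = S powr (1 / q)"
    by (simp add: lp_norm_def S_def)
  have "g $ i * w $ i = \<bar>g $ i\<bar> powr q" for i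
    using powr_mult_base[of "\<bar>g $ i\<bar>" "q - 1"]
    by (simp add: w_def mult.assoc[symmetric] abs_sgn[symmetric])
  then have gw: "inner g w = S"
    by (simp add: inner_vec_def S_def)
  have "S \<ge> 0"
    by (simp add: S_def sum_nonneg)
  then have S: "S = lp_norm q g * lp_norm p w"
    using q by (simp add: w g flip: powr_add)
  have "lp_norm q g \<noteq> 0"
    using False q by (simp add: lp_norm_eq_0_iff)
  then have w0: "lp_norm p w > 0"
    using w g by simp
  define c where "c = lp_norm q g / lp_norm p w"
  have c: "c \<ge> 0" "c * lp_norm p w = lp_norm q g"
    using w0 by (auto simp: c_def lp_norm_nonneg)
  show ?thesis
  proof
    show "lp_norm p (c *\<^sub>R w) = lp_norm (dual_exponent p) g"
      using c p by (simp add: lp_norm_scaleR q_def)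
    have "inner g (c *\<^sub>R w) = lp_norm q g * (c * lp_norm p w)"
      by (simp add: gw S)
    then show "inner g (c *\<^sub>R w) = (lp_norm (dual_exponent p) g)\<^sup>2"
      by (simp add: c power2_eq_square q_def)
  qed
qed

text \<open>Duality replaces Minkowski's inequality: Hoelder is applied to \<open>u\<close> and
  \<open>v\<close> against the dual vector of \<open>u + v\<close>, and one factor is
  cancelled.\<close>

lemma dual_norm_triangle:
  fixes u v :: "real ^ 'n"
  assumes p: "p > 1"
  shows "lp_norm (dual_exponent p) (u + v) \<le> lp_norm (dual_exponent p) u + lp_norm (dual_exponent p) v"
proof -
  let ?N = "lp_norm (dual_exponent p)"
  obtain w where w: "lp_norm p w = ?N (u + v)" "inner (u + v) w = (?N (u + v))\<^sup>2"
    using lp_duality_map[OF p] .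
  have "?N (u + v) * ?N (u + v) \<le> (?N u + ?N v) * ?N (u + v)"
    using Holder_inner[OF p, of u w] Holder_inner[OF p, of v w] w
    by (simp add: inner_add_left power2_eq_square algebra_simps)
  then show ?thesis
    using lp_norm_nonneg[of "dual_exponent p"] by (smt (verit) mult_right_le_imp_le)
qed

section \<open>First-order optimality, the descent inequality and tangent bounds\<close>

lemma quadratic_nonneg_imp_linear_zero:
  fixes b c :: real
  assumes "b \<ge> 0" and *: "\<And>e. e * c + e\<^sup>2 * b \<ge> 0"
  shows "c = 0"
proof -
  \<comment> \<open>Any small step against the sign of \<open>c\<close> makes the quadratic negative
    unless \<open>c = 0\<close>; the denominator \<open>b + 1\<close> keeps the witness valid when
    \<open>b = 0\<close>.\<close>
  have "(- c / (b + 1)) * c + (- c / (b + 1))\<^sup>2 * b = - c\<^sup>2 / (b + 1)\<^sup>2"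
    using \<open>b \<ge> 0\<close> by (simp add: divide_simps) (simp add: power2_eq_square algebra_simps)
  with *[of "- c / (b + 1)"] have "c\<^sup>2 / (b + 1)\<^sup>2 \<le> 0" by simp
  then show ?thesis
    using \<open>b \<ge> 0\<close> by (simp add: divide_le_0_iff)
qed

lemma minimizes_iff: "minimizes (h :: 'a \<Rightarrow> real) z \<longleftrightarrow> (\<forall>y. h z \<le> h y)"
  by (simp add: is_arg_min_linorder)

text \<open>With \<open>N\<close> the length of the step from \<open>y\<close> to \<open>x\<close>,
  optimality bounds the dual norm of \<open>grad f y\<close> by \<open>2 * L * N\<close> and
  smoothness adds \<open>L * N\<close>, so that of \<open>grad f x\<close> is at most
  \<open>3 * L * N\<close>: hence the 9. The inner product is at least
  \<open>2 * L * N\<^sup>2 - L * N\<^sup>2\<close>.\<close>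

lemma lp_smooth_descent:
  fixes f :: "real ^ 'n \<Rightarrow> real"
  assumes p: "p > 1" and L: "L > 0" and smooth: "lp_smooth p L f"
    and min: "minimizes (\<lambda>z. inner (grad f y) (z - y) + L * (lp_norm p (z - y))\<^sup>2) x"
  shows "(lp_norm (dual_exponent p) (grad f x))\<^sup>2 / (9 * L) \<le> inner (grad f x) (y - x)"
proof -
  define q where "q = dual_exponent p"
  define g h N where "g = grad f y" and "h = x - y" and "N = lp_norm p h"
  have N: "N \<ge> 0"
    by (simp add: N_def lp_norm_nonneg)
  have opt: "inner g h + L * N\<^sup>2 \<le> inner g z + L * (lp_norm p z)\<^sup>2" for z
    using min by (auto simp: minimizes_iff g_def h_def N_def dest: spec[of _ "y + z"])
  \<comment> \<open>Varying the minimizer only along its own ray, to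
    \<open>(1 + e) *\<^sub>R h\<close>, gives this stationarity condition without differentiating
    the norm.\<close>
  have "inner g h + 2 * L * N\<^sup>2 = 0"
  proof (rule quadratic_nonneg_imp_linear_zero[where b = "L * N\<^sup>2"])
    fix e :: real
    show "0 \<le> e * (inner g h + 2 * L * N\<^sup>2) + e\<^sup>2 * (L * N\<^sup>2)"
      using opt[of "(1 + e) *\<^sub>R h"] p
      unfolding lp_norm_scaleR[OF order.strict_trans[OF zero_less_one p]] N_def[symmetric] power_mult_distrib
      by (simp add: power2_eq_square algebra_simps)
  qed (use L in simp)
  then have gh: "inner g h = - 2 * L * N\<^sup>2" by simp
  obtain w where w: "lp_norm p w = lp_norm q g" "inner g w = (lp_norm q g)\<^sup>2"
    using lp_duality_map[OF p, of g] unfolding q_def .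
  \<comment> \<open>This multiple of the dual vector gives the model the value
    \<open>- (lp_norm q g)\<^sup>2 / (4 * L)\<close>, to be compared with the minimal value
    \<open>- L * N\<^sup>2\<close>.\<close>
  have w': "lp_norm p ((- 1 / (2 * L)) *\<^sub>R w) = lp_norm q g / (2 * L)"
    using p L by (subst lp_norm_scaleR) (simp_all add: w)
  have "- (L * N\<^sup>2) \<le> - ((lp_norm q g)\<^sup>2 / (4 * L))"
    using opt[of "(- 1 / (2 * L)) *\<^sub>R w"] L
    unfolding inner_scaleR_right gh w w' by (simp add: power2_eq_square field_simps)
  then have "(lp_norm q g)\<^sup>2 \<le> (2 * L * N)\<^sup>2"
    using L by (simp add: field_simps power2_eq_square)
  then have g: "lp_norm q g \<le> 2 * L * N"
    using L N by (simp add: abs_le_square_iff[symmetric] lp_norm_nonneg)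
  have d: "lp_norm q (grad f x - g) \<le> L * N"
    using smooth by (simp add: lp_smooth_def q_def g_def N_def h_def)
  have "lp_norm q (grad f x) \<le> 3 * L * N"
    using dual_norm_triangle[OF p, of g "grad f x - g"] g d by (simp add: q_def)
  then have "(lp_norm q (grad f x))\<^sup>2 \<le> (3 * L * N)\<^sup>2"
    by (intro power_mono lp_norm_nonneg)
  then have "(lp_norm q (grad f x))\<^sup>2 / (9 * L) \<le> L * N\<^sup>2"
    using L by (simp add: field_simps power2_eq_square)
  moreover have "inner (grad f x - g) h \<le> L * N * N"
    using Holder_inner[OF p, of "grad f x - g" h] mult_right_mono[OF d N] by (simp add: q_def N_def)
  ultimately show ?thesis
    using gh by (simp add: q_def h_def inner_diff_left inner_diff_right power2_eq_square)
qed

text \<open>Restricting \<open>f\<close> to the line through \<open>x\<close> and \<open>z\<close>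
  reduces this to the tangent inequality in one variable.\<close>

lemma convex_on_above_GDERIV:
  fixes f :: "'a::real_inner \<Rightarrow> real"
  assumes convex: "convex_on UNIV f" and D: "GDERIV f x :> D"
  shows "f x + inner D (z - x) \<le> f z"
proof -
  define l where "l = (\<lambda>s::real. x + s *\<^sub>R (z - x))"
  have conv: "convex_on UNIV (f \<circ> l)"
  proof (rule convex_onI)
    fix t a b :: real assume t: "0 < t" "t < 1"
    have "l ((1 - t) *\<^sub>R a + t *\<^sub>R b) = (1 - t) *\<^sub>R l a + t *\<^sub>R l b"
      by (simp add: l_def algebra_simps)
    then show "(f \<circ> l) ((1 - t) *\<^sub>R a + t *\<^sub>R b) \<le> (1 - t) * (f \<circ> l) a + t * (f \<circ> l) b"
      using convex_onD[OF convex, of t "l a" "l b"] t by simp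
  qed simp
  have "(l has_derivative (\<lambda>s. s *\<^sub>R (z - x))) (at 0)"
    unfolding l_def by (auto intro!: derivative_eq_intros)
  moreover have "(f has_derivative (\<lambda>h. inner h D)) (at (l 0))"
    using D by (simp add: gderiv_def l_def)
  ultimately have "((f \<circ> l) has_derivative (\<lambda>h. inner h D) \<circ> (\<lambda>s. s *\<^sub>R (z - x))) (at 0)"
    by (rule diff_chain_at)
  then have "((f \<circ> l) has_field_derivative inner D (z - x)) (at 0)"
    by (simp add: has_field_derivative_def o_def inner_commute mult_commute_abs)
  from convex_on_imp_above_tangent[OF conv connected_UNIV _ _ this, of 1] show ?thesis
    by (simp add: l_def)
qed

text \<open>The second-order expansion of \<open>h\<close> at \<open>v\<close> is exact, and its
  linear term vanishes because \<open>v\<close> is a minimizer.\<close>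

lemma minimizer_of_quadratic:
  fixes c v x0 :: "'a::real_inner"
  assumes min: "minimizes h v"
    and h: "\<And>z. h z = 1/2 * (norm (z - x0))\<^sup>2 + inner c z + b"
  shows "h v + 1/2 * (norm (z - v))\<^sup>2 \<le> h z"
proof -
  have expand: "h (v + e *\<^sub>R (z - v)) = h v + e * inner (v - x0 + c) (z - v) + e\<^sup>2 * (1/2 * (norm (z - v))\<^sup>2)" for e
    unfolding h power2_norm_eq_inner
    by (simp add: inner_simps inner_commute power2_eq_square) (simp add: field_simps)
  have "inner (v - x0 + c) (z - v) = 0"
  proof (rule quadratic_nonneg_imp_linear_zero[where b = "1/2 * (norm (z - v))\<^sup>2"])
    fix e
    have "h v \<le> h (v + e *\<^sub>R (z - v))"
      using min unfolding minimizes_iff by blast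
    then show "0 \<le> e * inner (v - x0 + c) (z - v) + e\<^sup>2 * (1/2 * (norm (z - v))\<^sup>2)"
      unfolding expand by simp
  qed simp
  with expand[of 1] show ?thesis by simp
qed

section \<open>Shape and two-sided bounds of the estimating sequence\<close>

lemma hasd_psi_quadratic:
  assumes run: "hasd_run p L f T x0 x v y \<psi> \<rho> a A \<tau>" and "t \<le> T"
  shows "\<exists>c b. \<forall>z. \<psi> t z = 1/2 * (norm (z - x0))\<^sup>2 + inner c z + b"
  using \<open>t \<le> T\<close>
proof (induction t)
  case 0
  show ?case
    using run by (intro exI[of _ 0]) (simp add: hasd_run_def)
next
  case (Suc t)
  then obtain c b where "\<And>z. \<psi> t z = 1/2 * (norm (z - x0))\<^sup>2 + inner c z + b"
    by auto
  moreover have "\<psi> (Suc t) z = \<psi> t z + a (Suc t) *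
      (f (x (Suc t)) + inner (grad f (x (Suc t))) (z - x (Suc t)))" for z
    using run Suc.prems by (simp add: hasd_run_def hasd_step_def)
  ultimately show ?case
    \<comment> \<open>An update adds an affine function, so the quadratic part stays that of
      \<open>\<psi> 0\<close>.\<close>
    by (intro exI[of _ "c + a (Suc t) *\<^sub>R grad f (x (Suc t))"]
        exI[of _ "b + a (Suc t) * (f (x (Suc t)) - inner (grad f (x (Suc t))) (x (Suc t)))"])
      (simp add: inner_simps algebra_simps)
qed

lemma hasd_A_nonneg:
  assumes run: "hasd_run p L f T x0 x v y \<psi> \<rho> a A \<tau>" and "t \<le> T"
  shows "A t \<ge> 0"
  using \<open>t \<le> T\<close>
proof (induction t)
  case (Suc t)
  have "hasd_step p L f x v y \<psi> \<rho> a A \<tau> t"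
    using run Suc.prems by (simp add: hasd_run_def)
  then have "A (Suc t) = A t + a (Suc t)" "a (Suc t) > 0"
    by (simp_all add: hasd_step_def)
  with Suc show ?case by simp
qed (use run in \<open>simp add: hasd_run_def\<close>)

text \<open>Each update adds a tangent minorant of \<open>f\<close> with weight
  \<open>a (Suc t)\<close>, and these weights add up to \<open>A\<close>.\<close>

lemma hasd_psi_upper:
  assumes run: "hasd_run p L f T x0 x v y \<psi> \<rho> a A \<tau>" and "t \<le> T"
    and grad_le: "\<And>x z. f x + inner (grad f x) (z - x) \<le> f z"
  shows "\<psi> t z \<le> 1/2 * (norm (z - x0))\<^sup>2 + A t * f z"
  using \<open>t \<le> T\<close>
proof (induction t)
  case (Suc t)
  let ?x = "x (Suc t)"
  have "hasd_step p L f x v y \<psi> \<rho> a A \<tau> t"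
    using run Suc.prems by (simp add: hasd_run_def)
  then have "A (Suc t) = A t + a (Suc t)" "a (Suc t) > 0"
    "\<psi> (Suc t) z = \<psi> t z + a (Suc t) * (f ?x + inner (grad f ?x) (z - ?x))"
    by (simp_all add: hasd_step_def)
  moreover have "a (Suc t) * (f ?x + inner (grad f ?x) (z - ?x)) \<le> a (Suc t) * f z"
    using \<open>a (Suc t) > 0\<close> by (intro mult_left_mono grad_le) simp
  ultimately show ?case
    using Suc by (simp add: algebra_simps)
qed (use run in \<open>simp add: hasd_run_def\<close>)

lemma hasd_psi_lower:
  assumes p: "p > 1" and L: "L > 0" and smooth: "lp_smooth p L f"
    and run: "hasd_run p L f T x0 x v y \<psi> \<rho> a A \<tau>" and "t \<le> T"
    and grad_le: "\<And>x z. f x + inner (grad f x) (z - x) \<le> f z"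
  shows "A t * f (x t) \<le> \<psi> t z"
  using \<open>t \<le> T\<close>
\<comment> \<open>The induction hypothesis is needed at \<open>v t\<close>, not at
  \<open>z\<close>.\<close>
proof (induction t arbitrary: z)
  case 0
  have \<psi>0: "\<psi> 0 z = 1/2 * (norm (z - x0))\<^sup>2" and A0: "A 0 = 0"
    using run unfolding hasd_run_def by blast+
  show ?case
    unfolding \<psi>0 A0 by simp
next
  case (Suc t)
  define X g a' A' D where "X = x (Suc t)" and "g = grad f X" and "a' = a (Suc t)"
    and "A' = A (Suc t)" and "D = lp_norm (dual_exponent p) g"
  have step: "hasd_step p L f x v y \<psi> \<rho> a A \<tau> t"
    using run Suc.prems by (simp add: hasd_run_def)
  then have A': "A' = A t + a'" and a': "a' > 0" and g0: "g \<noteq> 0" and \<rho>0: "\<rho> t > 0"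
    and \<rho>: "1/2 * ((norm g)\<^sup>2 / D\<^sup>2) \<le> \<rho> t"
    and a2: "a'\<^sup>2 = (A t + a') / (18 * L * \<rho> t)" and \<tau>: "\<tau> t = a' / A'"
    and y: "y t = (1 - \<tau> t) *\<^sub>R x t + \<tau> t *\<^sub>R v t"
    and min: "minimizes (\<lambda>z. inner (grad f (y t)) (z - y t) + L * (lp_norm p (z - y t))\<^sup>2) X"
    and \<psi>: "\<psi> (Suc t) z = \<psi> t z + a' * (f X + inner g (z - X))"
    unfolding hasd_step_def X_def g_def a'_def A'_def D_def by blast+
  have A0: "A t \<ge> 0"
    using hasd_A_nonneg[OF run] Suc.prems by simp
  with A' a' have A'0: "A' > 0" by simp
  have D0: "D > 0"
    using g0 dual_exponent_props[OF p] by (simp add: D_def lp_norm_pos)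
  \<comment> \<open>The lower bound on \<open>\<rho> t\<close> costs a factor 2, which together with
    the 9 of \<open>lp_smooth_descent\<close> accounts for the 18 in the equation for
    \<open>a\<close>.\<close>
  have "(norm g)\<^sup>2 \<le> 2 * \<rho> t * D\<^sup>2"
    using \<rho> D0 by (simp add: field_simps)
  then have "a'\<^sup>2 * (norm g)\<^sup>2 \<le> a'\<^sup>2 * (2 * \<rho> t * D\<^sup>2)"
    by (intro mult_left_mono) auto
  also have "\<dots> = A' * (D\<^sup>2 / (9 * L))"
    using \<rho>0 L by (simp add: a2 flip: A')
  also have "\<dots> \<le> A' * inner g (y t - X)"
    using lp_smooth_descent[OF p L smooth min] A'0
    by (intro mult_left_mono) (auto simp: g_def D_def)
  finally have descent: "a'\<^sup>2 * (norm g)\<^sup>2 \<le> A' * inner g (y t - X)" .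
  have "A' *\<^sub>R y t = A t *\<^sub>R x t + a' *\<^sub>R v t"
    using A'0 A' by (simp add: y \<tau> scaleR_add_right left_diff_distrib right_diff_distrib)
  then have y_inner: "A' * inner g (y t) = A t * inner g (x t) + a' * inner g (v t)"
    by (metis inner_add_right inner_scaleR_right)
  obtain c b where "\<And>z. \<psi> t z = 1/2 * (norm (z - x0))\<^sup>2 + inner c z + b"
    using hasd_psi_quadratic[OF run, of t] Suc.prems by auto
  moreover have "minimizes (\<psi> t) (v t)"
    using step by (simp add: hasd_step_def)
  ultimately have strong: "\<psi> t (v t) + 1/2 * (norm (z - v t))\<^sup>2 \<le> \<psi> t z"
    by (intro minimizer_of_quadratic)
  have IH: "A t * f (x t) \<le> \<psi> t (v t)"
    using Suc by simp
  have conv: "A t * (f X + inner g (x t - X)) \<le> A t * f (x t)"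
    unfolding g_def by (intro mult_left_mono grad_le A0)
  \<comment> \<open>Completing the square bounds the new linear term from below by
    \<open>- 1/2 * (a'\<^sup>2 * (norm g)\<^sup>2)\<close>, a loss that \<open>descent\<close>
    covers.\<close>
  have "0 \<le> 1/2 * (norm (z - v t + a' *\<^sub>R g))\<^sup>2"
    by simp
  also have "\<dots> = 1/2 * (norm (z - v t))\<^sup>2 + a' * inner g (z - v t) + 1/2 * (a'\<^sup>2 * (norm g)\<^sup>2)"
    unfolding power2_norm_eq_inner
    by (simp add: inner_simps inner_commute power2_eq_square) (simp add: field_simps)
  finally have "0 \<le> 1/2 * (norm (z - v t))\<^sup>2 + a' * inner g (z - v t) + A' * inner g (y t - X)"
    using descent zero_le_power2[of "a' * norm g"] unfolding power_mult_distrib by linarith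
  \<comment> \<open>As \<open>A' *\<^sub>R y t\<close> is the weighted sum of \<open>x t\<close> and
    \<open>v t\<close>, the terms in \<open>v t\<close> cancel. What remains are the tangent at
    \<open>X\<close> evaluated at \<open>x t\<close>, handled by \<open>conv\<close>, and the term
    added to \<open>\<psi> t\<close>.\<close>
  moreover have "A' * inner g (y t - X) + a' * inner g (z - v t)
      = A t * inner g (x t - X) + a' * inner g (z - X)"
    using y_inner A' by (simp add: inner_diff_right algebra_simps)
  ultimately have "A' * f X \<le> \<psi> (Suc t) z"
    using strong IH conv A' unfolding \<psi> by (simp add: algebra_simps)
  then show ?case by (simp add: A'_def X_def)
qed

section \<open>Growth of the weights \<open>A\<close>\<close>

lemma hasd_sqrt_A_step:
  assumes p: "p > 1" and L: "L > 0"
    and step: "hasd_step p L f x v y \<psi> \<rho> a A \<tau> t" and A0: "A t \<ge> 0"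
  shows "sqrt (A t) + lp_norm (dual_exponent p) (grad f (x (Suc t))) / norm (grad f (x (Suc t))) / (12 * sqrt L)
    \<le> sqrt (A (Suc t))"
proof -
  define g where "g = grad f (x (Suc t))"
  define r where "r = lp_norm (dual_exponent p) g / norm g"
  define a' A' where "a' = a (Suc t)" and "A' = A (Suc t)"
  have A': "A' = A t + a'" and a': "a' > 0" and g0: "g \<noteq> 0" and \<rho>0: "\<rho> t > 0"
    and \<rho>: "\<rho> t \<le> 2 * ((norm g)\<^sup>2 / (lp_norm (dual_exponent p) g)\<^sup>2)"
    and a2: "a'\<^sup>2 = A' / (18 * L * \<rho> t)"
    using step by (simp_all add: hasd_step_def g_def a'_def A'_def)
  have A'0: "A' > 0"
    using A0 A' a' by simp
  have "lp_norm (dual_exponent p) g > 0"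
    using g0 dual_exponent_props[OF p] by (simp add: lp_norm_pos)
  then have r0: "r > 0" and "\<rho> t * r\<^sup>2 \<le> 2"
    using \<rho> g0 by (simp_all add: r_def field_simps)
  \<comment> \<open>The upper bound on \<open>\<rho> t\<close> turns the 18 in the equation for
    \<open>a\<close> into 36, whose root is the 6 here.\<close>
  have "(r / (6 * sqrt L) * sqrt A')\<^sup>2 = A' * r\<^sup>2 / (36 * L)"
    using L A'0 by (simp add: power_mult_distrib power_divide)
  also have "\<dots> \<le> a'\<^sup>2"
    using \<open>\<rho> t * r\<^sup>2 \<le> 2\<close> L \<rho>0 A'0 by (simp add: a2 field_simps)
  finally have "r / (6 * sqrt L) * sqrt A' \<le> a'"
    by (rule power2_le_imp_le) (use a' in simp)
  \<comment> \<open>Factoring the increment of \<open>A\<close> converts it into an increment of the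
    square root; bounding the second factor by \<open>2 * sqrt A'\<close> turns 6 into 12.\<close>
  also have "a' = (sqrt A' - sqrt (A t)) * (sqrt A' + sqrt (A t))"
    using A'0 A0 A' by (simp add: algebra_simps)
  also have "\<dots> \<le> (sqrt A' - sqrt (A t)) * (2 * sqrt A')"
    using A' a' by (intro mult_left_mono) auto
  finally have "r / (6 * sqrt L) \<le> 2 * (sqrt A' - sqrt (A t))"
    using A'0 by (subst mult_le_cancel_right_pos[symmetric, of "sqrt A'"]) (simp_all add: mult_ac)
  then show ?thesis
    by (simp add: r_def A'_def g_def)
qed

lemma hasd_sqrt_A_lower:
  assumes p: "p > 1" and L: "L > 0"
    and run: "hasd_run p L f T x0 x v y \<psi> \<rho> a A \<tau>" and "t \<le> T"
  shows "(\<Sum>s<t. lp_norm (dual_exponent p) (grad f (x (Suc s))) / norm (grad f (x (Suc s)))) / (12 * sqrt L)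
    \<le> sqrt (A t)"
  using \<open>t \<le> T\<close>
proof (induction t)
  case (Suc t)
  have "hasd_step p L f x v y \<psi> \<rho> a A \<tau> t"
    using run Suc.prems by (simp add: hasd_run_def)
  from hasd_sqrt_A_step[OF p L this] hasd_A_nonneg[OF run] Suc show ?case
    by (simp add: add_divide_distrib)
qed (use run in \<open>simp add: hasd_run_def\<close>)

theorem theorem4:
  fixes f :: "real ^ 'n \<Rightarrow> real"
    and p L G :: real
    and T :: nat
    and x0 xstar :: "real ^ 'n"
    and x v y :: "nat \<Rightarrow> real ^ 'n"
    and \<psi> :: "nat \<Rightarrow> real ^ 'n \<Rightarrow> real"
    and \<rho> a A \<tau> :: "nat \<Rightarrow> real"
  assumes "p \<ge> 2"
    and "L > 0"
    and "convex_on UNIV f"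
    and "lp_smooth p L f"
    and "minimizes f xstar"
    and "T > 0"
    and "hasd_run p L f T x0 x v y \<psi> \<rho> a A \<tau>"
    and "G = 1 / real T *
      (\<Sum>t<T. lp_norm (dual_exponent p) (grad f (x (Suc t))) / norm (grad f (x (Suc t))))"
  shows "f (x T) - f xstar \<le> 324 * L * (norm (x0 - xstar))\<^sup>2 / (G\<^sup>2 * (real T)\<^sup>2)"
proof -
  have p: "p > 1"
    using assms(1) by simp
  have grad_le: "f x + inner (grad f x) (z - x) \<le> f z" for x z
    using assms(4)
    by (intro convex_on_above_GDERIV[OF assms(3)] differentiable_imp_GDERIV_grad) (simp add: lp_smooth_def)
  define S where "S = (\<Sum>t<T. lp_norm (dual_exponent p) (grad f (x (Suc t))) / norm (grad f (x (Suc t))))"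
  have "lp_norm (dual_exponent p) (grad f (x (Suc t))) / norm (grad f (x (Suc t))) > 0" if "t < T" for t
  proof -
    have "grad f (x (Suc t)) \<noteq> 0"
      using assms(7) that by (simp add: hasd_run_def hasd_step_def)
    then show ?thesis
      using dual_exponent_props[OF p] by (simp add: lp_norm_pos)
  qed
  then have S0: "S > 0"
    unfolding S_def using assms(6) by (intro sum_pos) auto
  have GT: "G\<^sup>2 * (real T)\<^sup>2 = S\<^sup>2"
    using assms(6,8) by (simp add: S_def power_divide)
  have A0: "A T \<ge> 0"
    using hasd_A_nonneg[OF assms(7)] by simp
  have "S / (12 * sqrt L) \<le> sqrt (A T)"
    unfolding S_def by (rule hasd_sqrt_A_lower[OF p assms(2,7) order_refl])
  then have "(S / (12 * sqrt L))\<^sup>2 \<le> (sqrt (A T))\<^sup>2"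
    using S0 assms(2) by (intro power_mono) auto
  then have S: "S\<^sup>2 \<le> 144 * L * A T"
    using assms(2) A0 by (simp add: power_divide power_mult_distrib field_simps)
  have gap: "A T * f (x T) \<le> 1/2 * (norm (xstar - x0))\<^sup>2 + A T * f xstar"
    using hasd_psi_lower[OF p assms(2,4,7) order_refl grad_le]
      hasd_psi_upper[OF assms(7) order_refl grad_le] by (rule order_trans)
  have "f xstar \<le> f (x T)"
    using assms(5) unfolding minimizes_iff by simp
  \<comment> \<open>Minimality of \<open>xstar\<close> makes the gap nonnegative, so
    \<open>S\<^sup>2\<close> can be replaced by its upper bound.\<close>
  then have "S\<^sup>2 * (f (x T) - f xstar) \<le> 144 * L * A T * (f (x T) - f xstar)"
    using S by (intro mult_right_mono) auto
  also have "\<dots> = 144 * L * (A T * f (x T) - A T * f xstar)"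
    by (simp add: algebra_simps)
  also have "\<dots> \<le> 144 * L * (1/2 * (norm (xstar - x0))\<^sup>2)"
    using gap assms(2) by (intro mult_left_mono) auto
  \<comment> \<open>The constant reached here is 72, so 324 leaves room to spare.\<close>
  also have "\<dots> \<le> 324 * L * (norm (x0 - xstar))\<^sup>2"
    using assms(2) by (simp add: norm_minus_commute)
  finally show ?thesis
    using S0 by (simp add: GT field_simps)
qed

end
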